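(* Let $m\ge 3$ and $l\ge 2$ be integers. Then $\chi_{=}(K_1\circ^l C_m)=3$ if $m=4$, and $\chi_{=}(K_1\circ^l C_m)=4$ otherwise.
   Context: All graphs are finite, simple and connected. $K_1$ is the single-vertex graph and $C_m$ the cycle on $m$ vertices. A graph is equitably $k$-colorable if its vertex set can be partitioned into $k$ (possibly empty) independent sets $V_1,\dots,V_k$ with $||V_i|-|V_j||\le 1$ for all $i,j$; $\chi_{=}(G)$ is the least $k$ for which $G$ is equitably $k$-colorable. The corona $G\circ H$ is formed from one copy of $G$ and $|V(G)|$ copies of $H$, the $i$-th vertex of $G$ being joined to every vertex of the $i$-th copy of $H$; $G\circ^1 H=G\circ H$ and $G\circ^l H=(G\circ^{l-1}H)\circ H$ for $l\ge 2$. *)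

theory Defs
  imports "Graph_Theory.Graph_Theory" "HOL-Library.Disjoint_Sets"
begin

text \<open>
  Finite simple graphs are rendered as the symmetric loop-free pair digraphs of the locale
  \<open>pair_graph\<close>: the edge \<open>uv\<close> is the pair of arcs \<open>(u, v)\<close>, \<open>(v, u)\<close>.
\<close>

definition single_vertex_graph :: "unit pair_pre_digraph" where
  "single_vertex_graph = \<lparr> pverts = {()}, parcs = {} \<rparr>"

text \<open>This is the cycle on \<open>m\<close> vertices only for \<open>m \<ge> 3\<close>.\<close>

definition cycle_graph :: "nat \<Rightarrow> nat pair_pre_digraph" where
  "cycle_graph m = \<lparr> pverts = {..<m},
     parcs = {(i, j). i < m \<and> j < m \<and> (j = (i + 1) mod m \<or> i = (j + 1) mod m)} \<rparr>"

text \<open>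
  The corona is iterated, so its vertices have to live in the same type as those of its first
  argument. In a corona of \<open>G\<close> and \<open>H\<close>, \<open>Centre u\<close> is the vertex \<open>u\<close> of the copy of \<open>G\<close> and
  \<open>Leaf u h\<close> is the vertex \<open>h\<close> of the copy of \<open>H\<close> that belongs to \<open>u\<close>; \<open>Base\<close> embeds the
  vertices of the initial graph.
\<close>

datatype ('a, 'b) corona_vertex =
    Base 'a
  | Centre "('a, 'b) corona_vertex"
  | Leaf "('a, 'b) corona_vertex" 'b

definition base_graph :: "'a pair_pre_digraph \<Rightarrow> ('a, 'b) corona_vertex pair_pre_digraph" where
  "base_graph G = \<lparr> pverts = Base ` pverts G, parcs = {(Base u, Base v) | u v. (u, v) \<in> parcs G} \<rparr>"

definition corona ::
  "('a, 'b) corona_vertex pair_pre_digraph \<Rightarrow> 'b pair_pre_digraph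
    \<Rightarrow> ('a, 'b) corona_vertex pair_pre_digraph" where
  "corona G H = \<lparr>
     pverts = {Centre u | u. u \<in> pverts G} \<union> {Leaf u h | u h. u \<in> pverts G \<and> h \<in> pverts H},
     parcs = {(Centre u, Centre v) | u v. (u, v) \<in> parcs G}
       \<union> {(Leaf u h, Leaf u k) | u h k. u \<in> pverts G \<and> (h, k) \<in> parcs H}
       \<union> {(Centre u, Leaf u h) | u h. u \<in> pverts G \<and> h \<in> pverts H}
       \<union> {(Leaf u h, Centre u) | u h. u \<in> pverts G \<and> h \<in> pverts H} \<rparr>"

text \<open>The case \<open>0\<close> is a copy of \<open>G\<close> itself, so that the case \<open>1\<close> is the corona of \<open>G\<close> and \<open>H\<close>.\<close>

primrec iter_corona ::
  "'a pair_pre_digraph \<Rightarrow> nat \<Rightarrow> 'b pair_pre_digraph \<Rightarrow> ('a, 'b) corona_vertex pair_pre_digraph"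
where
  "iter_corona G 0 H = base_graph G"
| "iter_corona G (Suc l) H = corona (iter_corona G l H) H"

definition independent_set :: "'a pair_pre_digraph \<Rightarrow> 'a set \<Rightarrow> bool" where
  "independent_set G S \<longleftrightarrow> S \<subseteq> pverts G \<and> (\<forall>u\<in>S. \<forall>v\<in>S. (u, v) \<notin> parcs G)"

definition equitably_colorable :: "'a pair_pre_digraph \<Rightarrow> nat \<Rightarrow> bool" where
  "equitably_colorable G k \<longleftrightarrow>
     (\<exists>V :: nat \<Rightarrow> 'a set.
        (\<Union>i<k. V i) = pverts G \<and> disjoint_family_on V {..<k} \<and>
        (\<forall>i<k. independent_set G (V i)) \<and>
        (\<forall>i<k. \<forall>j<k. \<bar>int (card (V i)) - int (card (V j))\<bar> \<le> 1))"

text \<open>The minimum exists for every finite simple graph: take all colour classes to be singletons.\<close>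

definition equitable_chromatic_number :: "'a pair_pre_digraph \<Rightarrow> nat" (\<open>\<chi>\<^sub>=\<close>) where
  "\<chi>\<^sub>= G = (LEAST k. equitably_colorable G k)"

lemma pair_graphI:
  assumes "finite (pverts G)" "parcs G \<subseteq> pverts G \<times> pverts G" "sym (parcs G)"
    "\<And>u. (u, u) \<notin> parcs G"
  shows "pair_graph G"
proof -
  have "finite (parcs G)"
    using assms(1,2) by (meson finite_SigmaI finite_subset)
  then show ?thesis
    using assms by unfold_locales (auto simp: symmetric_def arcs_ends_def arc_to_ends_def)
qed

lemma pair_graphD:
  assumes "pair_graph G"
  shows "finite (pverts G)" "parcs G \<subseteq> pverts G \<times> pverts G" "sym (parcs G)" "(u, u) \<notin> parcs G"
proof -
  interpret pair_graph G by fact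
  show "finite (pverts G)" by (rule pair_finite_verts)
  show "parcs G \<subseteq> pverts G \<times> pverts G"
    using arc_fst_in_verts arc_snd_in_verts by fastforce
  show "sym (parcs G)"
    using pair_sym_arcs by (simp add: symmetric_def)
  show "(u, u) \<notin> parcs G"
    using pair_no_loops by fastforce
qed

lemma pair_graph_single_vertex_graph: "pair_graph single_vertex_graph"
  by (rule pair_graphI) (auto simp: single_vertex_graph_def sym_def)

lemma pair_graph_cycle_graph: "m \<ge> 3 \<Longrightarrow> pair_graph (cycle_graph m)"
  by (rule pair_graphI) (auto simp: cycle_graph_def sym_def mod_Suc split: if_splits)

lemma pair_graph_base_graph: "pair_graph G \<Longrightarrow> pair_graph (base_graph G)"
  by (rule pair_graphI) (auto simp: base_graph_def sym_def dest: pair_graphD symD)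

lemma pair_graph_corona:
  assumes "pair_graph G" "pair_graph H"
  shows "pair_graph (corona G H)"
proof (rule pair_graphI)
  note G = pair_graphD[OF assms(1)] and H = pair_graphD[OF assms(2)]
  have "pverts (corona G H) =
      Centre ` pverts G \<union> (\<lambda>(u, h). Leaf u h) ` (pverts G \<times> pverts H)"
    by (auto simp: corona_def)
  then show "finite (pverts (corona G H))"
    using G(1) H(1) by simp
  show "parcs (corona G H) \<subseteq> pverts (corona G H) \<times> pverts (corona G H)"
    using G(2) H(2) by (auto simp: corona_def)
  show "sym (parcs (corona G H))"
    using G(3) H(3) by (auto simp: corona_def sym_def)
  show "(u, u) \<notin> parcs (corona G H)" for u
    using G(4) H(4) by (auto simp: corona_def)
qed

lemma pair_graph_iter_corona:
  "pair_graph G \<Longrightarrow> pair_graph H \<Longrightarrow> pair_graph (iter_corona G l H)"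
  by (induction l) (simp_all add: pair_graph_base_graph pair_graph_corona)

lemma equitably_colorable_card_pverts:
  assumes "pair_graph G"
  shows "equitably_colorable G (card (pverts G))"
proof -
  obtain f where f: "bij_betw f {..<card (pverts G)} (pverts G)"
    using pair_graphD(1)[OF assms] bij_betw_from_nat_into_finite by blast
  have img: "f ` {..<card (pverts G)} = pverts G" and inj: "inj_on f {..<card (pverts G)}"
    using f by (auto simp: bij_betw_def)
  show ?thesis
    unfolding equitably_colorable_def
  proof (intro exI conjI)
    show "(\<Union>i<card (pverts G). {f i}) = pverts G"
      using img by auto
    show "disjoint_family_on (\<lambda>i. {f i}) {..<card (pverts G)}"
      using inj by (auto simp: disjoint_family_on_def inj_on_def)
    show "\<forall>i<card (pverts G). independent_set G {f i}"
      using img pair_graphD(4)[OF assms] by (auto simp: independent_set_def)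
  qed simp
qed

end

theory Submission
  imports Defs
begin

text \<open>
  In a 3-colouring of a corona with \<open>C\<^sub>m\<close> each copy of the cycle uses only the two colours other
  than that of its centre, so it alternates: \<open>m\<close> is even, and passing to the corona multiplies the
  differences of the class sizes by \<open>1 - m div 2\<close>. Starting from \<open>K\<^sub>1\<close> the largest difference is
  therefore \<open>(m div 2 - 1) ^ l\<close>, which exceeds 1 unless \<open>m = 4\<close>.

  For the upper bound, a cycle has a colouring with prescribed class sizes as soon as these add up
  to \<open>m\<close> and none exceeds \<open>m div 2\<close>. It remains to choose class sizes for every copy of the cycle.
  For odd \<open>m = 2 * h + 1\<close> the class sizes are \<open>(1, h, h, 1)\<close> at level 1, and at level 2 they can all
  be made equal, after which any choice that is symmetric in the four colours keeps them equal.
  For even \<open>m\<close> they are kept equal up to one surplus or one deficient class; the symmetric choice is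
  corrected at one copy for each of three colours, which makes up for the vertices in excess.
\<close>

section \<open>Colourings with prescribed class sizes\<close>

definition proper_coloring :: "'a pair_pre_digraph \<Rightarrow> nat \<Rightarrow> ('a \<Rightarrow> nat) \<Rightarrow> bool" where
  "proper_coloring G k f \<longleftrightarrow>
     (\<forall>v\<in>pverts G. f v < k) \<and> (\<forall>u v. (u, v) \<in> parcs G \<longrightarrow> f u \<noteq> f v)"

definition class_size :: "'a pair_pre_digraph \<Rightarrow> ('a \<Rightarrow> nat) \<Rightarrow> nat \<Rightarrow> nat" where
  "class_size G f i = card {v \<in> pverts G. f v = i}"

text \<open>Only the vector of class sizes is carried from one corona to the next, so the
  constructions reduce to arithmetic on such vectors. The values of \<open>n\<close> from
  \<open>k\<close> on are irrelevant.\<close>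

definition colorable_with :: "'a pair_pre_digraph \<Rightarrow> nat \<Rightarrow> (nat \<Rightarrow> nat) \<Rightarrow> bool" where
  "colorable_with G k n \<longleftrightarrow>
     (\<exists>f. proper_coloring G k f \<and> (\<forall>i<k. class_size G f i = n i))"

text \<open>Partitions and colourings correspond through fibres. \<open>pair_graph\<close> puts both
  ends of every arc into some class.\<close>

lemma equitably_colorable_iff:
  assumes "pair_graph G"
  shows "equitably_colorable G k \<longleftrightarrow>
    (\<exists>n. colorable_with G k n \<and> (\<forall>i<k. \<forall>j<k. \<bar>int (n i) - int (n j)\<bar> \<le> 1))"
    (is "_ \<longleftrightarrow> ?R")
proof
  assume "equitably_colorable G k"
  then obtain V where V: "(\<Union>i<k. V i) = pverts G" "disjoint_family_on V {..<k}"
      "\<And>i. i < k \<Longrightarrow> independent_set G (V i)"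
      "\<forall>i<k. \<forall>j<k. \<bar>int (card (V i)) - int (card (V j))\<bar> \<le> 1"
    unfolding equitably_colorable_def by blast
  define f where "f v = (THE i. i < k \<and> v \<in> V i)" for v
  have f: "f v = i" if "i < k" "v \<in> V i" for v i
    unfolding f_def using that V(2) by (auto simp: disjoint_family_on_def intro!: the_equality)
  have cls: "{v \<in> pverts G. f v = i} = V i" if "i < k" for i
  proof (intro equalityI subsetI)
    fix v assume "v \<in> {v \<in> pverts G. f v = i}"
    then obtain j where "j < k" "v \<in> V j" "f v = i"
      using V(1) by auto
    then show "v \<in> V i" using f by metis
  qed (use f that V(1) in auto)
  have "proper_coloring G k f"
    unfolding proper_coloring_def
  proof (intro conjI ballI allI impI)
    show "f v < k" if "v \<in> pverts G" for v
      using that V(1) f by auto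
    show "f u \<noteq> f v" if "(u, v) \<in> parcs G" for u v
    proof -
      have "u \<in> pverts G" "v \<in> pverts G"
        using pair_graphD(2)[OF assms] that by auto
      then obtain i j where "i < k" "u \<in> V i" "j < k" "v \<in> V j"
        using V(1) by blast
      then show ?thesis
        using V(3)[of i] that f by (auto simp: independent_set_def)
    qed
  qed
  then show ?R
    using cls V(4) unfolding colorable_with_def class_size_def
    by (intro exI[of _ "\<lambda>i. card (V i)"]) auto
next
  assume ?R
  then obtain f where f: "proper_coloring G k f"
      "\<forall>i<k. \<forall>j<k. \<bar>int (class_size G f i) - int (class_size G f j)\<bar> \<le> 1"
    unfolding colorable_with_def by auto
  show "equitably_colorable G k"
    unfolding equitably_colorable_def
    using f by (intro exI[of _ "\<lambda>i. {v \<in> pverts G. f v = i}"])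
      (auto simp: proper_coloring_def class_size_def disjoint_family_on_def independent_set_def,
        metis)
qed

subsection \<open>Colourings of a corona\<close>

lemma proper_coloring_corona_iff:
  "proper_coloring (corona G H) k f \<longleftrightarrow>
     proper_coloring G k (\<lambda>u. f (Centre u)) \<and>
     (\<forall>u\<in>pverts G. proper_coloring H k (\<lambda>h. f (Leaf u h)) \<and>
        (\<forall>h\<in>pverts H. f (Leaf u h) \<noteq> f (Centre u)))"
    (is "_ \<longleftrightarrow> ?R")
proof
  assume "proper_coloring (corona G H) k f"
  then have verts: "\<And>x. x \<in> pverts (corona G H) \<Longrightarrow> f x < k"
    and arcs: "\<And>x y. (x, y) \<in> parcs (corona G H) \<Longrightarrow> f x \<noteq> f y"
    by (auto simp: proper_coloring_def)
  show ?R
    unfolding proper_coloring_def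
  proof (intro conjI ballI allI impI)
    show "f (Centre u) < k" if "u \<in> pverts G" for u
      using that by (intro verts) (simp add: corona_def)
    show "f (Centre u) \<noteq> f (Centre v)" if "(u, v) \<in> parcs G" for u v
      using that by (intro arcs) (simp add: corona_def)
    show "f (Leaf u h) < k" if "u \<in> pverts G" "h \<in> pverts H" for u h
      using that by (intro verts) (simp add: corona_def)
    show "f (Leaf u h) \<noteq> f (Leaf u h')" if "u \<in> pverts G" "(h, h') \<in> parcs H" for u h h'
      using that by (intro arcs) (simp add: corona_def)
    show "f (Leaf u h) \<noteq> f (Centre u)" if "u \<in> pverts G" "h \<in> pverts H" for u h
      using that by (intro arcs) (simp add: corona_def)
  qed
next
  assume R: ?R
  show "proper_coloring (corona G H) k f"
    unfolding proper_coloring_def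
  proof (intro conjI ballI allI impI)
    show "f x < k" if "x \<in> pverts (corona G H)" for x
      using that R by (auto simp: corona_def proper_coloring_def)
    fix x y assume "(x, y) \<in> parcs (corona G H)"
    then consider (centre) u v where "x = Centre u" "y = Centre v" "(u, v) \<in> parcs G"
      | (leaf) u h h' where "x = Leaf u h" "y = Leaf u h'" "u \<in> pverts G" "(h, h') \<in> parcs H"
      | (spoke) u h where "{x, y} = {Centre u, Leaf u h}" "u \<in> pverts G" "h \<in> pverts H"
      by (auto simp: corona_def doubleton_eq_iff)
    then show "f x \<noteq> f y"
    proof cases
      case spoke
      then have "f (Leaf u h) \<noteq> f (Centre u)" using R by blast
      then show ?thesis using spoke(1) by (auto simp: doubleton_eq_iff)
    qed (use R in \<open>simp_all add: proper_coloring_def\<close>)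
  qed
qed

lemma class_size_corona:
  assumes "finite (pverts G)" "finite (pverts H)"
  shows "class_size (corona G H) f i =
    class_size G (\<lambda>u. f (Centre u)) i + (\<Sum>u\<in>pverts G. class_size H (\<lambda>h. f (Leaf u h)) i)"
proof -
  let ?C = "{u \<in> pverts G. f (Centre u) = i}"
  let ?L = "SIGMA u : pverts G. {h \<in> pverts H. f (Leaf u h) = i}"
  have "{v \<in> pverts (corona G H). f v = i} = Centre ` ?C \<union> (\<lambda>(u, h). Leaf u h) ` ?L"
    by (auto simp: corona_def)
  then have "class_size (corona G H) f i = card (Centre ` ?C \<union> (\<lambda>(u, h). Leaf u h) ` ?L)"
    by (simp only: class_size_def)
  also have "\<dots> = card (Centre ` ?C) + card ((\<lambda>(u, h). Leaf u h) ` ?L)"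
    using assms by (intro card_Un_disjoint) auto
  also have "card (Centre ` ?C) = card ?C"
    by (intro card_image) (simp add: inj_on_def)
  also have "card ((\<lambda>(u, h). Leaf u h) ` ?L) = card ?L"
    by (intro card_image) (auto simp: inj_on_def)
  also have "card ?L = (\<Sum>u\<in>pverts G. card {h \<in> pverts H. f (Leaf u h) = i})"
    using assms by (intro card_SigmaI) auto
  finally show ?thesis
    by (simp only: class_size_def)
qed

subsection \<open>Colourings of a cycle with prescribed class sizes\<close>

text \<open>The word \<open>w\<close> consists of \<open>x 0\<close> zeros, then \<open>x 1\<close>
  ones, and so on; its monotonicity makes every colour class an interval of positions.\<close>

lemma mono_blocks_exist:
  fixes x :: "nat \<Rightarrow> nat"
  obtains w :: "nat \<Rightarrow> nat" where "mono_on {..<\<Sum>i<k. x i} w" "\<And>j. j < (\<Sum>i<k. x i) \<Longrightarrow> w j < k"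
    "\<And>i. i < k \<Longrightarrow> card {j. j < (\<Sum>i<k. x i) \<and> w j = i} = x i"
proof (induction k arbitrary: thesis)
  case 0
  then show ?case by (simp add: mono_on_def)
next
  case (Suc k)
  let ?s = "\<Sum>i<k. x i"
  obtain w where w: "mono_on {..<?s} w" "\<And>j. j < ?s \<Longrightarrow> w j < k"
      "\<And>i. i < k \<Longrightarrow> card {j. j < ?s \<and> w j = i} = x i"
    using Suc.IH by blast
  let ?w = "\<lambda>j. if j < ?s then w j else k"
  show ?case
  proof (rule Suc.prems)
    show "mono_on {..<\<Sum>i<Suc k. x i} ?w"
      using w(1,2) by (fastforce simp: mono_on_def intro: less_imp_le)
    show "?w j < Suc k" for j
      using w(2)[of j] by auto
    fix i assume i: "i < Suc k"
    show "card {j. j < (\<Sum>i<Suc k. x i) \<and> ?w j = i} = x i"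
    proof (cases "i = k")
      case True
      then have "{j. j < (\<Sum>i<Suc k. x i) \<and> ?w j = i} = {?s..<?s + x k}"
        using w(2) nat_neq_iff by (auto simp: not_less[symmetric] split: if_splits) blast
      then show ?thesis using True by simp
    next
      case False
      then have "{j. j < (\<Sum>i<Suc k. x i) \<and> ?w j = i} = {j. j < ?s \<and> w j = i}"
        using i by auto
      then show ?thesis using w(3)[of i] i False by simp
    qed
  qed
qed

text \<open>
  If the vertices of the cycle are listed with the even positions first and then the odd ones,
  neighbours are at distance at least \<open>m div 2\<close> in the list, except that for even \<open>m = 2 * h\<close>
  some of them are at distance \<open>h - 1\<close>, but then neither of the two is the first or the last in
  the list. Hence colour classes that are intervals of length at most \<open>m div 2\<close> are independent,
  provided that a longest interval comes first.
\<close>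

definition evens_first :: "nat \<Rightarrow> nat \<Rightarrow> nat" where
  "evens_first m j = (if even j then j div 2 else (m + 1) div 2 + j div 2)"

lemma bij_betw_evens_first: "bij_betw (evens_first m) {..<m} {..<m}"
proof -
  have "inj_on (evens_first m) {..<m}"
    by (auto simp: inj_on_def evens_first_def elim!: evenE oddE split: if_splits)
  moreover have "evens_first m ` {..<m} \<subseteq> {..<m}"
    by (auto simp: evens_first_def elim!: oddE)
  ultimately show ?thesis
    by (simp add: bij_betw_def endo_inj_surj)
qed

lemma cycle_colorable_with_max_first:
  assumes sum: "(\<Sum>i<k. x i) = m" and bound: "\<And>i. i < k \<Longrightarrow> x i \<le> m div 2"
    and max: "\<And>i. i < k \<Longrightarrow> x i \<le> x 0"
  shows "colorable_with (cycle_graph m) k x"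
proof -
  obtain w where w: "mono_on {..<m} w" "\<And>j. j < m \<Longrightarrow> w j < k"
      "\<And>i. i < k \<Longrightarrow> card {j. j < m \<and> w j = i} = x i"
    using mono_blocks_exist[where k = k and x = x] unfolding sum by blast
  \<comment> \<open>A monotone word with equal values at \<open>a\<close> and \<open>b\<close> is
    constant in between.\<close>
  have interval: "x (w a) \<ge> b - a + 1" if "w a = w b" "a \<le> b" "b < m" for a b
  proof -
    have const: "w j = w a" if "j \<in> {a..b}" for j
      using monotone_onD[OF w(1), of a j] monotone_onD[OF w(1), of j b] that \<open>b < m\<close> \<open>w a = w b\<close>
      by auto
    have "{a..b} \<subseteq> {j. j < m \<and> w j = w a}"
    proof
      fix j assume "j \<in> {a..b}"
      then show "j \<in> {j. j < m \<and> w j = w a}"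
        using const[of j] \<open>b < m\<close> by simp
    qed
    then have "card {a..b} \<le> card {j. j < m \<and> w j = w a}"
      by (intro card_mono) auto
    then show ?thesis
      using w(2)[of a] w(3)[of "w a"] that by auto
  qed
  have far: "w a \<noteq> w b" if "a + m div 2 \<le> b" "b < m" for a b
    using interval[of a b] bound[of "w a"] w(2)[of a] that by fastforce
  \<comment> \<open>A block containing \<open>a\<close> and \<open>b\<close> has at least
    \<open>h\<close> positions, so by maximality the first block has exactly \<open>h\<close>. If
    that block contains \<open>a\<close>, it reaches from 0 to \<open>b\<close> and is too long;
    otherwise it fits before \<open>a\<close>, and \<open>b\<close> would be the last position or
    beyond.\<close>
  have near: "w a \<noteq> w b" if "a > 0" "m = 2 * h" "b + 1 = a + h" "b + 1 < m" for a b h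
  proof
    assume eq: "w a = w b"
    have h: "h \<le> x (w a)" "w a < k"
      using interval[OF eq] w(2)[of a] that by auto
    have "w 0 = 0"
    proof (rule ccontr)
      assume "w 0 \<noteq> 0"
      then have "w j \<noteq> 0" if "j < m" for j
        using monotone_onD[OF w(1), of 0 j] that by auto
      then have "{j. j < m \<and> w j = 0} = {}" by blast
      then have "x 0 = 0"
        using w(3)[of 0] h(2) by (metis card.empty gr_zeroI not_less0)
      then show False
        using max[OF h(2)] h(1) that by auto
    qed
    have x0: "x 0 = h"
      using max[OF h(2)] h bound[of 0] that by fastforce
    have "w a = 0"
    proof (rule ccontr)
      assume "w a \<noteq> 0"
      have "{j. j < m \<and> w j = 0} \<subseteq> {..<a}"
      proof
        fix j assume "j \<in> {j. j < m \<and> w j = 0}"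
        then show "j \<in> {..<a}"
          using monotone_onD[OF w(1), of a j] \<open>w a \<noteq> 0\<close> by (cases "a \<le> j") simp_all
      qed
      then have "card {j. j < m \<and> w j = 0} \<le> a"
        by (metis card_lessThan card_mono finite_lessThan)
      then have "h \<le> a"
        using w(3)[of 0] h(2) x0 by auto
      then show False using that by simp
    qed
    then show False
      using interval[of 0 b] \<open>w 0 = 0\<close> eq x0 that by auto
  qed
  let ?f = "\<lambda>j. w (evens_first m j)"
  have lt: "evens_first m j < m" if "j < m" for j
    using bij_betw_evens_first[of m] that by (auto simp: bij_betw_def)
  \<comment> \<open>The closing edge and the edges leaving an even \<open>j\<close> join positions
    at distance at least \<open>m div 2\<close>, so \<open>far\<close> suffices for them.\<close>
  have step: "?f j \<noteq> ?f ((j + 1) mod m)" if "j < m" for j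
  proof (cases "j + 1 = m")
    case True
    have "m div 2 \<le> evens_first m j"
      using True by (auto simp: evens_first_def elim!: evenE oddE)
    then have "w 0 \<noteq> ?f j"
      using far[of 0 "evens_first m j"] lt[OF that] by simp
    then show ?thesis
      using True by (simp add: evens_first_def)
  next
    case False
    then have j: "j + 1 < m" using that by simp
    then have mod: "(j + 1) mod m = j + 1" by simp
    show ?thesis
    proof (cases "even j")
      case True
      then have "evens_first m j + m div 2 \<le> evens_first m (j + 1)"
        by (simp add: evens_first_def)
      then show ?thesis
        using far[OF _ lt[OF j]] mod by simp
    next
      case False
      then obtain i where i: "j = 2 * i + 1" by (auto elim: oddE)
      have e: "evens_first m j = (m + 1) div 2 + i" "evens_first m (j + 1) = i + 1"
        by (simp_all add: evens_first_def i)
      \<comment> \<open>The distance is \<open>(m + 1) div 2 - 1\<close>: still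
        \<open>m div 2\<close> for odd \<open>m\<close>, but one short of it for even
        \<open>m\<close>, where \<open>near\<close> takes over.\<close>
      have "w (i + 1) \<noteq> w ((m + 1) div 2 + i)"
      proof (cases "even m")
        case True
        then obtain h where "m = 2 * h" by (auto elim: evenE)
        then show ?thesis
          using near[of "i + 1" h "h + i"] i j by simp
      next
        case False
        then obtain h where "m = 2 * h + 1" by (auto elim: oddE)
        then show ?thesis
          using far[of "i + 1" "h + 1 + i"] i j by simp
      qed
      then show ?thesis
        unfolding mod e by simp
    qed
  qed
  have "proper_coloring (cycle_graph m) k ?f"
    unfolding proper_coloring_def
  proof (intro conjI ballI allI impI)
    show "?f v < k" if "v \<in> pverts (cycle_graph m)" for v
      using that lt w(2) by (simp add: cycle_graph_def)
    show "?f u \<noteq> ?f v" if "(u, v) \<in> parcs (cycle_graph m)" for u v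
      using that step[of u] step[of v] by (auto simp: cycle_graph_def)
  qed
  moreover have "class_size (cycle_graph m) ?f i = x i" if "i < k" for i
  proof -
    have inj: "inj_on (evens_first m) {..<m}" and img: "evens_first m ` {..<m} = {..<m}"
      using bij_betw_evens_first[of m] by (auto simp: bij_betw_def)
    have "evens_first m ` {j \<in> {..<m}. ?f j = i} = {j \<in> evens_first m ` {..<m}. w j = i}"
      by blast
    then have "card {j \<in> {..<m}. ?f j = i} = card {j \<in> {..<m}. w j = i}"
      unfolding img using inj
      by (metis (no_types, lifting) card_image inj_on_subset mem_Collect_eq subsetI)
    then show ?thesis
      using w(3)[OF that] by (simp add: class_size_def cycle_graph_def)
  qed
  ultimately show ?thesis
    unfolding colorable_with_def by blast
qed

lemma colorable_with_permute:
  assumes "colorable_with G k (\<lambda>i. n (p i))" "p permutes {..<k}"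
  shows "colorable_with G k n"
proof -
  obtain f where f: "proper_coloring G k f" "\<And>i. i < k \<Longrightarrow> class_size G f i = n (p i)"
    using assms(1) unfolding colorable_with_def by blast
  have "proper_coloring G k (\<lambda>v. p (f v))"
    using f(1) permutes_in_image[OF assms(2)] permutes_inj[OF assms(2)]
    by (auto simp: proper_coloring_def inj_eq)
  moreover have "class_size G (\<lambda>v. p (f v)) i = n i" if i: "i < k" for i
  proof -
    obtain j where j: "j < k" "i = p j"
      using permutes_image[OF assms(2)] i by blast
    then have "class_size G (\<lambda>v. p (f v)) i = class_size G f j"
      using permutes_inj[OF assms(2)] by (simp add: class_size_def inj_eq)
    then show ?thesis
      using f(2) j by simp
  qed
  ultimately show ?thesis
    unfolding colorable_with_def by blast
qed

text \<open>Putting a longest block first is a matter of naming colours: colour 0 is exchanged with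
  a colour \<open>p\<close> of maximal class size.\<close>

lemma cycle_colorable_with:
  assumes "(\<Sum>i<k. x i) = m" and "\<And>i. i < k \<Longrightarrow> x i \<le> m div 2"
  shows "colorable_with (cycle_graph m) k x"
proof (cases "k = 0")
  case True
  then show ?thesis
    using assms(1) by (intro cycle_colorable_with_max_first) auto
next
  case False
  then obtain p where p: "p < k" "\<And>i. i < k \<Longrightarrow> x i \<le> x p"
    using Max_in[of "x ` {..<k}"] Max_ge[of "x ` {..<k}"] by fastforce
  let ?t = "transpose 0 p"
  have t: "?t permutes {..<k}"
    using p False by (intro permutes_swap_id) auto
  have "colorable_with (cycle_graph m) k (\<lambda>i. x (?t i))"
  proof (rule cycle_colorable_with_max_first)
    show "(\<Sum>i<k. x (?t i)) = m"
      using sum.permute[OF t, of x] assms(1) by (simp add: comp_def)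
    show "x (?t i) \<le> m div 2" "x (?t i) \<le> x (?t 0)" if "i < k" for i
      using assms(2) p permutes_in_image[OF t, of i] that by auto
  qed
  then show ?thesis
    using t by (rule colorable_with_permute)
qed

lemma finite_pverts_cycle_graph: "finite (pverts (cycle_graph m))"
  by (simp add: cycle_graph_def)

subsection \<open>Extending a colouring to the corona with a cycle\<close>

text \<open>The class sizes allowed on a copy of the cycle whose centre has colour \<open>c\<close>:
  the spokes forbid \<open>c\<close>, and the other conditions are those of
  \<open>cycle_colorable_with\<close>.\<close>

definition cycle_profile :: "nat \<Rightarrow> nat \<Rightarrow> nat \<Rightarrow> (nat \<Rightarrow> nat) \<Rightarrow> bool" where
  "cycle_profile m k c x \<longleftrightarrow> x c = 0 \<and> (\<Sum>i<k. x i) = m \<and> (\<forall>i<k. x i \<le> m div 2)"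

text \<open>
  The copies of the cycle attached to the vertices of colour \<open>c\<close> are coloured with the class
  sizes \<open>M c\<close>, except for one copy for each \<open>c\<close>, which is coloured with the class sizes \<open>S c\<close>.
\<close>

lemma colorable_with_corona_cycle:
  assumes fin: "finite (pverts G)" and col: "colorable_with G k n"
    and M: "\<And>c. c < k \<Longrightarrow> cycle_profile m k c (M c)"
    and S: "\<And>c. c < k \<Longrightarrow> cycle_profile m k c (S c)"
  shows "colorable_with (corona G (cycle_graph m)) k
    (\<lambda>i. n i + (\<Sum>c<k. if n c = 0 then 0 else (n c - 1) * M c i + S c i))"
proof -
  obtain f where f: "proper_coloring G k f" "\<And>i. i < k \<Longrightarrow> class_size G f i = n i"
    using col unfolding colorable_with_def by blast
  have fk: "f u < k" if "u \<in> pverts G" for u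
    using f(1) that by (simp add: proper_coloring_def)
  \<comment> \<open>\<open>s c\<close> is the vertex of colour \<open>c\<close> whose copy is
    exceptional. If no vertex has colour \<open>c\<close>, there is no such copy, whence the case
    \<open>n c = 0\<close> in the class sizes.\<close>
  define s where "s c = (SOME v. v \<in> pverts G \<and> f v = c)" for c
  define P where "P u = (if u = s (f u) then S (f u) else M (f u))" for u
  have P: "cycle_profile m k (f u) (P u)" if "u \<in> pverts G" for u
    using M S fk[OF that] by (simp add: P_def)
  have "\<forall>u\<in>pverts G. colorable_with (cycle_graph m) k (P u)"
    using P unfolding cycle_profile_def by (intro ballI cycle_colorable_with) auto
  then obtain \<phi> where \<phi>: "\<And>u. u \<in> pverts G \<Longrightarrow> proper_coloring (cycle_graph m) k (\<phi> u)"
      "\<And>u i. u \<in> pverts G \<Longrightarrow> i < k \<Longrightarrow> class_size (cycle_graph m) (\<phi> u) i = P u i"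
    unfolding colorable_with_def by metis
  have avoid: "\<phi> u j \<noteq> f u" if "u \<in> pverts G" "j \<in> pverts (cycle_graph m)" for u j
  proof -
    have "class_size (cycle_graph m) (\<phi> u) (f u) = 0"
      using \<phi>(2)[OF that(1) fk[OF that(1)]] P[OF that(1)] by (simp add: cycle_profile_def)
    then have "{v \<in> pverts (cycle_graph m). \<phi> u v = f u} = {}"
      using finite_pverts_cycle_graph by (simp add: class_size_def)
    then show ?thesis using that by blast
  qed
  \<comment> \<open>The value 0 is a default: a corona has no \<open>Base\<close> vertices.\<close>
  let ?F = "case_corona_vertex (\<lambda>_. 0) f \<phi>"
  have "proper_coloring (corona G (cycle_graph m)) k ?F"
    using f(1) \<phi>(1) avoid by (simp add: proper_coloring_corona_iff)
  moreover have "class_size (corona G (cycle_graph m)) ?F i =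
      n i + (\<Sum>c<k. if n c = 0 then 0 else (n c - 1) * M c i + S c i)" if i: "i < k" for i
  proof -
    have class_sum: "(\<Sum>u | u \<in> pverts G \<and> f u = c. P u i) =
        (if n c = 0 then 0 else (n c - 1) * M c i + S c i)" if c: "c < k" for c
    proof -
      let ?V = "{u. u \<in> pverts G \<and> f u = c}"
      have card: "card ?V = n c"
        using f(2)[OF c] by (simp add: class_size_def)
      have finV: "finite ?V" using fin by simp
      show ?thesis
      proof (cases "n c = 0")
        case True
        then have "?V = {}" using card finV by simp
        then show ?thesis unfolding \<open>?V = {}\<close> using True by simp
      next
        case False
        then have "?V \<noteq> {}" using card by force
        then have s: "s c \<in> pverts G" "f (s c) = c"
          unfolding s_def using someI_ex[of "\<lambda>v. v \<in> pverts G \<and> f v = c"] by auto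
        have "(\<Sum>u\<in>?V. P u i) = P (s c) i + (\<Sum>u\<in>?V - {s c}. P u i)"
          using finV s by (intro sum.remove) auto
        also have "P (s c) i = S c i"
          using s by (simp add: P_def)
        also have "(\<Sum>u\<in>?V - {s c}. P u i) = (\<Sum>u\<in>?V - {s c}. M c i)"
          by (intro sum.cong) (auto simp: P_def)
        also have "\<dots> = (n c - 1) * M c i"
          using card s by (simp add: card_Diff_singleton)
        finally show ?thesis using False by simp
      qed
    qed
    have "(\<Sum>u\<in>pverts G. P u i) = (\<Sum>c<k. \<Sum>u | u \<in> pverts G \<and> f u = c. P u i)"
      using fin fk by (subst sum.group) auto
    also have "\<dots> = (\<Sum>c<k. if n c = 0 then 0 else (n c - 1) * M c i + S c i)"
      using class_sum by (intro sum.cong) auto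
    finally show ?thesis
      using f(2)[OF i] \<phi>(2) i fin finite_pverts_cycle_graph by (simp add: class_size_corona)
  qed
  ultimately show ?thesis
    unfolding colorable_with_def by blast
qed

lemma colorable_with_cong:
  assumes "colorable_with G k n" "\<forall>i<k. n i = n' i"
  shows "colorable_with G k n'"
  using assms unfolding colorable_with_def by auto

text \<open>The case in which the exceptional profiles equal the regular ones.\<close>

lemma colorable_with_corona_cycle_uniform:
  assumes "finite (pverts G)" "colorable_with G k n"
    and "\<And>c. c < k \<Longrightarrow> cycle_profile m k c (M c)"
  shows "colorable_with (corona G (cycle_graph m)) k (\<lambda>i. n i + (\<Sum>c<k. n c * M c i))"
proof (rule colorable_with_cong[OF colorable_with_corona_cycle[OF assms assms(3)]])
  show "\<forall>i<k. n i + (\<Sum>c<k. if n c = 0 then 0 else (n c - 1) * M c i + M c i) =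
      n i + (\<Sum>c<k. n c * M c i)"
    by (intro allI impI arg_cong2[where f = "(+)"] sum.cong refl) (simp add: mult_eq_if)
qed

subsection \<open>Equitable colourings of the iterated coronas\<close>

abbreviation K1_corona :: "nat \<Rightarrow> nat \<Rightarrow> (unit, nat) corona_vertex pair_pre_digraph" where
  "K1_corona l m \<equiv> iter_corona single_vertex_graph l (cycle_graph m)"

lemma finite_pverts_K1_corona: "finite (pverts (K1_corona l m))"
proof (induction l)
  case 0
  then show ?case
    by (simp add: base_graph_def single_vertex_graph_def)
next
  case (Suc l)
  have "pverts (K1_corona (Suc l) m) = Centre ` pverts (K1_corona l m) \<union>
      (\<lambda>(u, h). Leaf u h) ` (pverts (K1_corona l m) \<times> {..<m})"
    by (auto simp: corona_def cycle_graph_def)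
  then show ?case
    using Suc by simp
qed

lemma colorable_with_K1:
  assumes "k > 0" "n 0 = 1" "\<And>i. 0 < i \<Longrightarrow> i < k \<Longrightarrow> n i = 0"
  shows "colorable_with (K1_corona 0 m) k n"
proof -
  have "proper_coloring (K1_corona 0 m) k (\<lambda>_. 0)"
    using assms(1) by (auto simp: proper_coloring_def base_graph_def single_vertex_graph_def)
  moreover have "class_size (K1_corona 0 m) (\<lambda>_. 0) i = n i" if "i < k" for i
    using assms that by (cases "i = 0")
      (auto simp: class_size_def base_graph_def single_vertex_graph_def)
  ultimately show ?thesis
    unfolding colorable_with_def by blast
qed

lemma all_less_3: "(\<forall>i<3. P i) \<longleftrightarrow> P 0 \<and> P 1 \<and> P (2::nat)"
  by (auto simp: numeral_eq_Suc less_Suc_eq)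

lemma all_less_4: "(\<forall>i<4. P i) \<longleftrightarrow> P 0 \<and> P 1 \<and> P 2 \<and> P (3::nat)"
  by (auto simp: numeral_eq_Suc less_Suc_eq)

lemma sum_less_3: "(\<Sum>i<3. f i) = f 0 + f 1 + f (2::nat)"
  by (simp add: numeral_eq_Suc)

lemma sum_less_4: "(\<Sum>i<4. f i) = f 0 + f 1 + f 2 + f (3::nat)"
  by (simp add: numeral_eq_Suc)

text \<open>Every copy uses each of the two colours allowed to it twice. With \<open>N\<close>
  vertices in all, a class of size \<open>n\<close> grows to \<open>2 * N - n\<close>, so
  differences only change sign, and one surplus class alternates with one deficient class.\<close>

lemma K1_corona_4_cycle_colorable_with:
  "\<exists>q. colorable_with (K1_corona l 4) 3 ((!) [q + 1, q, q]) \<or>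
       colorable_with (K1_corona l 4) 3 ((!) [q, q + 1, q + 1])"
proof (induction l)
  case 0
  have "colorable_with (K1_corona 0 4) 3 ((!) [0 + 1, 0, 0])"
    by (rule colorable_with_K1) (auto simp: nth_Cons split: nat.splits)
  then show ?case by blast
next
  case (Suc l)
  let ?M = "\<lambda>c i. if c = i then 0 else 2 :: nat"
  have "\<forall>c<3. cycle_profile 4 3 c (?M c)"
    by (simp add: all_less_3 cycle_profile_def sum_less_3)
  then have step: "colorable_with (K1_corona (Suc l) 4) 3 (\<lambda>i. n i + (\<Sum>c<3. n c * ?M c i))"
    if "colorable_with (K1_corona l 4) 3 n" for n
    using colorable_with_corona_cycle_uniform[OF finite_pverts_K1_corona that, where M = ?M]
    by simp
  from Suc obtain q where "colorable_with (K1_corona l 4) 3 ((!) [q + 1, q, q]) \<or>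
      colorable_with (K1_corona l 4) 3 ((!) [q, q + 1, q + 1])" by blast
  then show ?case
  proof
    assume "colorable_with (K1_corona l 4) 3 ((!) [q + 1, q, q])"
    then have "colorable_with (K1_corona (Suc l) 4) 3
        ((!) [5 * q + 1, 5 * q + 1 + 1, 5 * q + 1 + 1])"
      by (rule colorable_with_cong[OF step]) (simp add: all_less_3 sum_less_3)
    then show ?thesis by blast
  next
    assume "colorable_with (K1_corona l 4) 3 ((!) [q, q + 1, q + 1])"
    then have "colorable_with (K1_corona (Suc l) 4) 3
        ((!) [5 * q + 3 + 1, 5 * q + 3, 5 * q + 3])"
      by (rule colorable_with_cong[OF step]) (simp add: all_less_3 sum_less_3)
    then show ?thesis by blast
  qed
qed

section \<open>Equal or nearly equal classes with four colours\<close>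

lemma K1_corona_step:
  assumes "colorable_with (K1_corona l m) 4 n"
    and "\<forall>c<4. cycle_profile m 4 c (M c)"
    and "\<forall>i<4. n i + (\<Sum>c<4. n c * M c i) = n' i"
  shows "colorable_with (K1_corona (Suc l) m) 4 n'"
  using colorable_with_cong[OF colorable_with_corona_cycle_uniform
      [OF finite_pverts_K1_corona assms(1)] assms(3)] assms(2) by simp

lemma K1_corona_step_special:
  assumes "colorable_with (K1_corona l m) 4 n"
    and "\<forall>c<4. cycle_profile m 4 c (M c)" and "\<forall>c<4. cycle_profile m 4 c (S c)"
    and "\<forall>i<4. n i + (\<Sum>c<4. if n c = 0 then 0 else (n c - 1) * M c i + S c i) = n' i"
  shows "colorable_with (K1_corona (Suc l) m) 4 n'"
  using colorable_with_cong[OF colorable_with_corona_cycle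
      [OF finite_pverts_K1_corona assms(1)] assms(4)] assms(2,3) by simp

text \<open>Row \<open>c\<close> of a table is the profile for centres of colour \<open>c\<close>.
  The table \<open>?B\<close> levels \<open>(1, h, h, 1)\<close>; it is also circulant with column
  sums \<open>2 * h + 1\<close>, so it preserves equality afterwards.\<close>

lemma K1_corona_odd_cycle_colorable_with:
  assumes "h \<ge> 1"
  shows "\<exists>q. colorable_with (K1_corona (l + 2) (2 * h + 1)) 4 ((!) [q, q, q, q])"
proof (induction l)
  case 0
  let ?m = "2 * h + 1"
  let ?A = "\<lambda>c. (!) ([[0, h, h, 1], [h, 0, 1, h], [h, 1, 0, h], [1, h, h, 0]] ! c)"
  let ?B = "\<lambda>c. (!) ([[0, h, 1, h], [h, 0, h, 1], [1, h, 0, h], [h, 1, h, 0]] ! c)"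
  have "colorable_with (K1_corona 0 ?m) 4 ((!) [1, 0, 0, 0])"
    by (rule colorable_with_K1) (auto simp: nth_Cons split: nat.splits)
  then have "colorable_with (K1_corona (Suc 0) ?m) 4 ((!) [1, h, h, 1])"
    by (rule K1_corona_step[where M = ?A])
      (use assms in \<open>simp_all add: all_less_4 sum_less_4 cycle_profile_def\<close>)
  then have "colorable_with (K1_corona (Suc (Suc 0)) ?m) 4
      ((!) [(h + 1)\<^sup>2, (h + 1)\<^sup>2, (h + 1)\<^sup>2, (h + 1)\<^sup>2])"
    by (rule K1_corona_step[where M = ?B])
      (use assms in \<open>simp_all add: all_less_4 sum_less_4 cycle_profile_def power2_eq_square\<close>)
  then show ?case
    by (auto simp: numeral_2_eq_2)
next
  case (Suc l)
  let ?B = "\<lambda>c. (!) ([[0, h, 1, h], [h, 0, h, 1], [1, h, 0, h], [h, 1, h, 0]] ! c)"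
  from Suc obtain q where "colorable_with (K1_corona (l + 2) (2 * h + 1)) 4 ((!) [q, q, q, q])"
    by blast
  then have "colorable_with (K1_corona (Suc (l + 2)) (2 * h + 1)) 4
      ((!) (replicate 4 (q * (2 * h + 2))))"
    by (rule K1_corona_step[where M = ?B])
      (use assms in \<open>simp_all add: all_less_4 sum_less_4 cycle_profile_def algebra_simps\<close>)
  then show ?case
    by (auto simp: numeral_eq_Suc)
qed

text \<open>The graph has \<open>(2 * h + 1) ^ (l + 2)\<close> vertices, which is 1 modulo 4 for
  even \<open>h\<close> and alternates between 1 and 3 for odd \<open>h\<close>. This leaves one
  surplus class or, for odd \<open>h\<close> only, one deficient class. The bound
  \<open>q \<ge> 1\<close> gives every colour a vertex whose copy can be exceptional.\<close>

lemma K1_corona_even_cycle_colorable_with: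
  assumes "h \<ge> 2"
  shows "\<exists>q\<ge>1. colorable_with (K1_corona (l + 2) (2 * h)) 4 ((!) [q + 1, q, q, q]) \<or>
    odd h \<and> colorable_with (K1_corona (l + 2) (2 * h)) 4 ((!) [q + 1, q + 1, q + 1, q])"
proof (induction l)
  case 0
  let ?m = "2 * h"
  let ?A = "\<lambda>c. (!) ([[0, h, h, 0], [h, 0, h, 0], [h, h, 0, 0], [h, h, 0, 0]] ! c)"
  let ?B = "\<lambda>c. (!) ([[0, h, h, 0], [h, 0, h - 1, 1], [1, h - 1, 0, h], [h, h, 0, 0]] ! c)"
  \<comment> \<open>At level 2 there are \<open>(2 * h + 1)^2 = 4 * ?q + 1\<close> vertices.\<close>
  let ?q = "h * (h + 1)"
  have "colorable_with (K1_corona 0 ?m) 4 ((!) [1, 0, 0, 0])"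
    by (rule colorable_with_K1) (auto simp: nth_Cons split: nat.splits)
  then have 1: "colorable_with (K1_corona (Suc 0) ?m) 4 ((!) [1, h, h, 0])"
    by (rule K1_corona_step[where M = ?A])
      (use assms in \<open>simp_all add: all_less_4 sum_less_4 cycle_profile_def\<close>)
  obtain h' where "h = Suc h'"
    using assms by (cases h) auto
  then have "colorable_with (K1_corona (Suc (Suc 0)) ?m) 4 ((!) [?q + 1, ?q, ?q, ?q])"
    by (intro K1_corona_step[where M = ?B, OF 1])
      (use assms in \<open>simp_all add: all_less_4 sum_less_4 cycle_profile_def algebra_simps\<close>)
  moreover have "?q \<ge> 1" using assms by simp
  ultimately show ?case
    by (metis add_0 numeral_2_eq_2)
next
  case (Suc l)
  let ?m = "2 * h"
  define g where "g = h div 2"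
  obtain e where e: "h = 2 * g + e" "e \<le> 1" "odd h \<longleftrightarrow> e = 1"
    using that[of "h mod 2"] by (auto simp: g_def odd_iff_mod_2_eq_one)
  have g: "g \<ge> 1" using assms by (auto simp: g_def)
  let ?a = "g + e" and ?b = "2 * g"
  \<comment> \<open>A circulant table with column sums \<open>2 * h\<close>: it adds the same amount
    to all classes when they are equal, so only the surplus vertices disturb the balance.\<close>
  let ?M = "\<lambda>c. (!) ([[0, ?a, ?b, ?a], [?a, 0, ?a, ?b], [?b, ?a, 0, ?a], [?a, ?b, ?a, 0]] ! c)"
  have M: "\<forall>c<4. cycle_profile ?m 4 c (?M c)"
    using e by (simp add: all_less_4 sum_less_4 cycle_profile_def)
  from Suc obtain q where q: "q \<ge> 1"
    and col: "colorable_with (K1_corona (l + 2) ?m) 4 ((!) [q + 1, q, q, q]) \<or>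
      odd h \<and> colorable_with (K1_corona (l + 2) ?m) 4 ((!) [q + 1, q + 1, q + 1, q])"
    by blast
  obtain q' where q': "q = Suc q'"
    using q by (cases q) auto
  show ?case
    using col
  proof (elim disjE conjE)
    \<comment> \<open>Row 3 agrees with \<open>?M\<close>; rows 0 to 2 absorb the imbalance caused
      by the extra vertex of colour 0. The new total \<open>(4 * q + 1) * (2 * h + 1)\<close> equals
      \<open>4 * ?Q + 2 * e + 1\<close>, so the outcome is a surplus class for \<open>e = 0\<close>
      and a deficient one for \<open>e = 1\<close>.\<close>
    let ?S = "\<lambda>c. (!) ([[0, h, h, 0], [h, 0, e, ?b], [?b, e, 0, h], [?a, ?b, ?a, 0]] ! c)"
    let ?Q = "q * (2 * h + 1) + g"
    have S: "\<forall>c<4. cycle_profile ?m 4 c (?S c)"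
      using e(1,2) g by (simp add: all_less_4 sum_less_4 cycle_profile_def)
    assume "colorable_with (K1_corona (l + 2) ?m) 4 ((!) [q + 1, q, q, q])"
    then have "colorable_with (K1_corona (Suc (l + 2)) ?m) 4 ((!) [?Q + 1, ?Q + e, ?Q + e, ?Q])"
      by (rule K1_corona_step_special[OF _ M S])
        (simp add: all_less_4 sum_less_4 q' e(1) algebra_simps)
    moreover have "e = 0 \<or> e = 1" "?Q \<ge> 1"
      using e g by auto
    ultimately show ?case
      using e(3) by (intro exI[of _ ?Q]) auto
  next
    \<comment> \<open>Again only rows 0 to 2 differ from \<open>?M\<close>. With
      \<open>h = 2 * g + 1\<close> the new total \<open>(4 * q + 3) * (2 * h + 1)\<close> equals
      \<open>4 * ?Q + 1\<close>, so a single surplus class returns.\<close>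
    let ?S = "\<lambda>c. (!) ([[0, g + 1, h, g], [h, 0, g, g + 1], [g + 1, 2 * g, 0, g + 1],
        [?a, ?b, ?a, 0]] ! c)"
    let ?Q = "q * (2 * h + 1) + 3 * g + 2"
    assume "odd h"
    then have "e = 1" using e(3) by simp
    then have h: "h = 2 * g + 1" using e(1) by simp
    have S: "\<forall>c<4. cycle_profile ?m 4 c (?S c)"
      using h \<open>e = 1\<close> g by (simp add: all_less_4 sum_less_4 cycle_profile_def)
    assume "colorable_with (K1_corona (l + 2) ?m) 4 ((!) [q + 1, q + 1, q + 1, q])"
    then have "colorable_with (K1_corona (Suc (l + 2)) ?m) 4 ((!) [?Q + 1, ?Q, ?Q, ?Q])"
      by (rule K1_corona_step_special[OF _ M S])
        (simp add: all_less_4 sum_less_4 q' h \<open>e = 1\<close> algebra_simps)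
    then show ?case
      by (intro exI[of _ ?Q]) auto
  qed
qed

subsection \<open>Lower bounds\<close>

lemma two_colored_cycle_alternates:
  assumes "proper_coloring (cycle_graph m) k f" "\<And>j. j < m \<Longrightarrow> f j = p \<or> f j = q"
    and "j < m"
  shows "f j = f 0 \<longleftrightarrow> even j"
  using \<open>j < m\<close>
proof (induction j)
  case (Suc j)
  have "(j, Suc j) \<in> parcs (cycle_graph m)"
    using Suc.prems by (simp add: cycle_graph_def)
  then have "f j \<noteq> f (Suc j)"
    using assms(1) unfolding proper_coloring_def by blast
  moreover have "f j = p \<or> f j = q" "f (Suc j) = p \<or> f (Suc j) = q" "f 0 = p \<or> f 0 = q"
    using assms(2)[of j] assms(2)[of "Suc j"] assms(2)[of 0] Suc.prems by linarith+
  ultimately have "f (Suc j) = f 0 \<longleftrightarrow> f j \<noteq> f 0"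
    by metis
  then show ?case
    using Suc by simp
qed simp

lemma card_even_less: "card {j. j < 2 * h \<and> even j} = h" "card {j. j < 2 * h \<and> odd j} = h"
proof -
  have "{j. j < 2 * h \<and> even j} = (\<lambda>i. 2 * i) ` {..<h}"
    by (auto elim!: evenE)
  then show "card {j. j < 2 * h \<and> even j} = h"
    by (simp add: card_image inj_on_def)
  have "{j. j < 2 * h \<and> odd j} = (\<lambda>i. 2 * i + 1) ` {..<h}"
    by (auto elim!: oddE)
  then show "card {j. j < 2 * h \<and> odd j} = h"
    by (simp add: card_image inj_on_def)
qed

text \<open>Alternation along the path from 0 to \<open>m - 1\<close>, together with the closing
  edge, forces \<open>m - 1\<close> to be odd. The hypotheses admit \<open>p = q\<close>, so the
  first conclusion also excludes monochromatic cycles.\<close>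

lemma two_colored_cycle:
  assumes "m \<ge> 3" "proper_coloring (cycle_graph m) k f" "\<And>j. j < m \<Longrightarrow> f j = p \<or> f j = q"
  shows "p \<noteq> q" "even m" "class_size (cycle_graph m) f p = m div 2"
    "class_size (cycle_graph m) f q = m div 2"
proof -
  note alt = two_colored_cycle_alternates[OF assms(2,3)]
  have f01: "f 1 \<noteq> f 0" using alt[of 1] assms(1) by simp
  then show "p \<noteq> q" using assms(3)[of 0] assms(3)[of 1] assms(1) by auto
  have "(0, m - 1) \<in> parcs (cycle_graph m)"
    using assms(1) by (simp add: cycle_graph_def)
  then have "f 0 \<noteq> f (m - 1)"
    using assms(2) unfolding proper_coloring_def by blast
  then show "even m"
    using alt[of "m - 1"] assms(1) by simp
  then obtain h where h: "m = 2 * h" by (auto elim: evenE)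
  have size: "class_size (cycle_graph m) f c = h" if "c = p \<or> c = q" for c
  proof (cases "c = f 0")
    case True
    then have "{j \<in> pverts (cycle_graph m). f j = c} = {j. j < 2 * h \<and> even j}"
      using alt h by (auto simp: cycle_graph_def)
    then show ?thesis by (simp add: class_size_def card_even_less)
  next
    case False
    have "f j = c \<longleftrightarrow> f j \<noteq> f 0" if "j < m" for j
      using assms(3)[OF that] assms(3)[of 0] that \<open>c = p \<or> c = q\<close> False by auto
    then have "{j \<in> pverts (cycle_graph m). f j = c} = {j. j < 2 * h \<and> odd j}"
      using alt h by (auto simp: cycle_graph_def)
    then show ?thesis by (simp add: class_size_def card_even_less)
  qed
  show "class_size (cycle_graph m) f p = m div 2" "class_size (cycle_graph m) f q = m div 2"
    using size h by auto
qed

lemma corona_cycle_three_coloring: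
  assumes "m \<ge> 3" "u \<in> pverts G" "proper_coloring (corona G (cycle_graph m)) 3 f"
  shows "even m" "i < 3 \<Longrightarrow> class_size (cycle_graph m) (\<lambda>h. f (Leaf u h)) i =
    (if f (Centre u) = i then 0 else m div 2)"
proof -
  let ?c = "f (Centre u)" and ?g = "\<lambda>h. f (Leaf u h)"
  have g: "proper_coloring (cycle_graph m) 3 ?g" "\<And>j. j < m \<Longrightarrow> ?g j \<noteq> ?c"
    using assms(2,3) by (auto simp: proper_coloring_corona_iff) (simp add: cycle_graph_def)
  have c: "?c < 3"
    using assms(2,3) unfolding proper_coloring_corona_iff by (simp add: proper_coloring_def)
  have g3: "?g j < 3" if "j < m" for j
    using g(1) that by (auto simp: proper_coloring_def cycle_graph_def)
  \<comment> \<open>The two colours below 3 other than that of the centre.\<close>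
  define p q :: nat where "p = (if ?c = 0 then 1 else 0)" and "q = (if ?c = 2 then 1 else 2)"
  then have pq: "i = p \<or> i = q" if "i < 3" "i \<noteq> ?c" for i
    using c that by (auto split: if_splits)
  have "?g j = p \<or> ?g j = q" if "j < m" for j
    using g(2)[OF that] g3[OF that] pq by blast
  note two = two_colored_cycle[OF assms(1) g(1) this]
  show "even m" by (rule two(2))
  show "class_size (cycle_graph m) ?g i = (if ?c = i then 0 else m div 2)" if "i < 3"
  proof (cases "?c = i")
    case True
    then have "{v \<in> pverts (cycle_graph m). ?g v = i} = {}"
      using g(2) by (auto simp: cycle_graph_def)
    then have "class_size (cycle_graph m) ?g i = 0"
      unfolding class_size_def by (simp only: card.empty)
    then show ?thesis using True by simp
  next
    case False
    then have "i = p \<or> i = q" using that pq by simp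
    then show ?thesis using two(3,4) False by auto
  qed
qed

lemma pverts_K1_corona_nonempty: "pverts (K1_corona l m) \<noteq> {}"
  by (induction l) (auto simp: base_graph_def single_vertex_graph_def corona_def)

lemma K1_corona_not_two_colorable:
  assumes "m \<ge> 3" "k \<le> 2"
  shows "\<not> proper_coloring (K1_corona (Suc l) m) k f"
proof
  assume f: "proper_coloring (K1_corona (Suc l) m) k f"
  obtain u where u: "u \<in> pverts (K1_corona l m)"
    using pverts_K1_corona_nonempty by blast
  have f': "proper_coloring (K1_corona l m) k (\<lambda>u. f (Centre u))"
    and g: "proper_coloring (cycle_graph m) k (\<lambda>h. f (Leaf u h))"
    and avoid: "\<And>j. j < m \<Longrightarrow> f (Leaf u j) \<noteq> f (Centre u)"
    using f u by (auto simp: proper_coloring_corona_iff) (simp add: cycle_graph_def)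
  have c: "f (Centre u) < k"
    using f' u by (simp add: proper_coloring_def)
  have g2: "f (Leaf u j) < k" if "j < m" for j
    using g that by (simp add: proper_coloring_def cycle_graph_def)
  \<comment> \<open>With at most two colours the centre leaves at most one for its copy; both
    alternatives name it, to contradict \<open>p \<noteq> q\<close>.\<close>
  have "f (Leaf u j) = 1 - f (Centre u) \<or> f (Leaf u j) = 1 - f (Centre u)" if "j < m" for j
    using c avoid[OF that] g2[OF that] assms(2) by linarith
  from two_colored_cycle(1)[OF assms(1) g this] show False by simp
qed

lemma K1_corona_three_coloring_spread:
  assumes "m \<ge> 3" "proper_coloring (K1_corona l m) 3 f"
  shows "\<exists>i<3. \<exists>j<3. \<bar>int (class_size (K1_corona l m) f i) - int (class_size (K1_corona l m) f j)\<bar>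
    = (int (m div 2) - 1) ^ l"
  using assms(2)
proof (induction l arbitrary: f)
  case 0
  let ?c = "f (Base ())"
  have c: "?c < 3"
    using 0 by (simp add: proper_coloring_def base_graph_def single_vertex_graph_def)
  define d where "d = (if ?c = 0 then 1 else 0 :: nat)"
  have d: "d < 3" "d \<noteq> ?c" by (auto simp: d_def)
  have V: "{v \<in> pverts (K1_corona 0 m). f v = ?c} = {Base ()}"
      "{v \<in> pverts (K1_corona 0 m). f v = d} = {}"
    using d by (auto simp: base_graph_def single_vertex_graph_def)
  have "class_size (K1_corona 0 m) f ?c = 1" "class_size (K1_corona 0 m) f d = 0"
    unfolding class_size_def V by simp_all
  then show ?case
    using c d by (intro exI[of _ ?c] conjI exI[of _ d]) simp_all
next
  case (Suc l)
  let ?G = "K1_corona l m" and ?g = "\<lambda>u. f (Centre u)"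
  let ?n = "class_size ?G ?g"
  have g: "proper_coloring ?G 3 ?g"
    using Suc.prems by (simp add: proper_coloring_corona_iff)
  then obtain i j where ij: "i < 3" "j < 3" "\<bar>int (?n i) - int (?n j)\<bar> = (int (m div 2) - 1) ^ l"
    using Suc.IH by blast
  \<comment> \<open>Written as an affine function of \<open>?n c\<close> over the integers, so that
    the term common to all colours cancels in differences.\<close>
  have size: "int (class_size (K1_corona (Suc l) m) f c) =
      int (m div 2) * int (card (pverts ?G)) - (int (m div 2) - 1) * int (?n c)" if c: "c < 3" for c
  proof -
    have "class_size (K1_corona (Suc l) m) f c =
        ?n c + (\<Sum>u\<in>pverts ?G. class_size (cycle_graph m) (\<lambda>h. f (Leaf u h)) c)"
      using class_size_corona[OF finite_pverts_K1_corona finite_pverts_cycle_graph] by simp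
    also have "(\<Sum>u\<in>pverts ?G. class_size (cycle_graph m) (\<lambda>h. f (Leaf u h)) c) =
        (\<Sum>u\<in>pverts ?G. if ?g u = c then 0 else m div 2)"
      using corona_cycle_three_coloring(2)[OF assms(1) _ Suc.prems[unfolded iter_corona.simps] c]
      by (intro sum.cong refl)
    also have "\<dots> = (\<Sum>u\<in>pverts ?G - {v \<in> pverts ?G. ?g v = c}. m div 2)"
      using finite_pverts_K1_corona[of l m] by (intro sum.mono_neutral_cong_right) auto
    also have "\<dots> = (card (pverts ?G) - ?n c) * (m div 2)"
      using finite_pverts_K1_corona[of l m] by (simp add: card_Diff_subset class_size_def)
    finally have eq: "class_size (K1_corona (Suc l) m) f c =
        ?n c + (card (pverts ?G) - ?n c) * (m div 2)" .
    have "?n c \<le> card (pverts ?G)"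
      unfolding class_size_def using finite_pverts_K1_corona[of l m] by (intro card_mono) auto
    then obtain d where "card (pverts ?G) = ?n c + d"
      by (metis le_iff_add)
    then show ?thesis
      unfolding eq by (simp add: algebra_simps)
  qed
  have "int (class_size (K1_corona (Suc l) m) f i) - int (class_size (K1_corona (Suc l) m) f j) =
      - ((int (m div 2) - 1) * (int (?n i) - int (?n j)))"
    unfolding size[OF ij(1)] size[OF ij(2)] by (simp add: algebra_simps)
  moreover have "int (m div 2) - 1 \<ge> 0" using assms(1) by linarith
  ultimately have "\<bar>int (class_size (K1_corona (Suc l) m) f i) -
      int (class_size (K1_corona (Suc l) m) f j)\<bar> = (int (m div 2) - 1) ^ Suc l"
    using ij(3) by (simp add: abs_mult)
  then show ?case using ij by blast
qed

text \<open>Any copy of the cycle forces \<open>m\<close> to be even, hence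
  \<open>m \<ge> 6\<close>, and then some two classes differ by at least 2.\<close>

lemma K1_corona_not_equitably_three_colorable:
  assumes "m \<ge> 3" "m \<noteq> 4"
  shows "\<not> equitably_colorable (K1_corona (Suc l) m) 3"
proof
  have graph: "pair_graph (K1_corona (Suc l) m)"
    by (intro pair_graph_iter_corona pair_graph_single_vertex_graph pair_graph_cycle_graph assms)
  assume "equitably_colorable (K1_corona (Suc l) m) 3"
  then obtain n f where f: "proper_coloring (K1_corona (Suc l) m) 3 f"
    and n: "\<forall>i<3. class_size (K1_corona (Suc l) m) f i = n i"
      "\<forall>i<3. \<forall>j<3. \<bar>int (n i) - int (n j)\<bar> \<le> 1"
    unfolding equitably_colorable_iff[OF graph] colorable_with_def by blast
  obtain u where "u \<in> pverts (K1_corona l m)"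
    using pverts_K1_corona_nonempty by blast
  then have "even m"
    by (rule corona_cycle_three_coloring(1)[OF assms(1) _ f[unfolded iter_corona.simps]])
  then have "m \<ge> 6" using assms by presburger
  then have base: "int (m div 2) - 1 \<ge> 2" by linarith
  then have "(int (m div 2) - 1) ^ Suc l \<ge> (int (m div 2) - 1) ^ 1"
    by (intro power_increasing) auto
  then have "(int (m div 2) - 1) ^ Suc l \<ge> 2"
    using base by (simp only: power_one_right)
  moreover obtain i j where ij: "i < 3" "j < 3"
    and spread: "\<bar>int (class_size (K1_corona (Suc l) m) f i) -
      int (class_size (K1_corona (Suc l) m) f j)\<bar> = (int (m div 2) - 1) ^ Suc l"
    using K1_corona_three_coloring_spread[OF assms(1) f] by blast
  moreover have "class_size (K1_corona (Suc l) m) f i = n i"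
      "class_size (K1_corona (Suc l) m) f j = n j" "\<bar>int (n i) - int (n j)\<bar> \<le> 1"
    using n ij by blast+
  ultimately show False
    by linarith
qed

theorem theorem6:
  fixes m l :: nat
  assumes "m \<ge> 3" and "l \<ge> 2"
  shows "\<chi>\<^sub>= (iter_corona single_vertex_graph l (cycle_graph m)) = (if m = 4 then 3 else 4)"
proof -
  obtain l' where l': "l = l' + 2" using assms(2) by (metis le_add_diff_inverse2)
  have graph: "pair_graph (K1_corona l m)"
    by (intro pair_graph_iter_corona pair_graph_single_vertex_graph pair_graph_cycle_graph assms)
  note eq_iff = equitably_colorable_iff[OF graph]
  \<comment> \<open>Equitable colourability is not monotone in \<open>k\<close> in general, so every
    smaller \<open>k\<close> is excluded, including 0 and 1.\<close>
  have not2: "\<not> equitably_colorable (K1_corona l m) k" if "k \<le> 2" for k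
    using K1_corona_not_two_colorable[OF assms(1) that, of "Suc l'"]
    unfolding eq_iff colorable_with_def unfolding l' add_2_eq_Suc' by blast
  show ?thesis
  proof (cases "m = 4")
    case True
    obtain q where "colorable_with (K1_corona l m) 3 ((!) [q + 1, q, q]) \<or>
        colorable_with (K1_corona l m) 3 ((!) [q, q + 1, q + 1])"
      using K1_corona_4_cycle_colorable_with True by blast
    then have "equitably_colorable (K1_corona l m) 3"
      unfolding eq_iff by (elim disjE; intro exI conjI) (assumption, simp add: all_less_3)+
    then have "\<chi>\<^sub>= (K1_corona l m) = 3"
      unfolding equitable_chromatic_number_def
      using not2 by (intro Least_equality) (force intro: leI)+
    then show ?thesis using True by simp
  next
    case False
    have "equitably_colorable (K1_corona l m) 4"
    proof (cases "even m")
      case True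
      then obtain h where h: "m = 2 * h" by (auto elim: evenE)
      then have "h \<ge> 2" using assms(1) by simp
      then obtain q where "colorable_with (K1_corona l m) 4 ((!) [q + 1, q, q, q]) \<or>
          colorable_with (K1_corona l m) 4 ((!) [q + 1, q + 1, q + 1, q])"
        using K1_corona_even_cycle_colorable_with unfolding h l' by blast
      then show ?thesis
        unfolding eq_iff by (elim disjE; intro exI conjI) (assumption, simp add: all_less_4)+
    next
      case False
      then obtain h where h: "m = 2 * h + 1" by (auto elim: oddE)
      then have "h \<ge> 1" using assms(1) by simp
      then obtain q where "colorable_with (K1_corona l m) 4 ((!) [q, q, q, q])"
        using K1_corona_odd_cycle_colorable_with unfolding h l' by blast
      then show ?thesis
        unfolding eq_iff by (intro exI conjI) (assumption, simp add: all_less_4)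
    qed
    moreover have "\<not> equitably_colorable (K1_corona l m) k" if "k < 4" for k
    proof (cases "k = 3")
      case True
      then show ?thesis
        using K1_corona_not_equitably_three_colorable[OF assms(1) False, of "Suc l'"] l' by simp
    qed (use not2 that in auto)
    ultimately have "\<chi>\<^sub>= (K1_corona l m) = 4"
      unfolding equitable_chromatic_number_def
      by (intro Least_equality) (force intro: leI)+
    then show ?thesis using False by simp
  qed
qed

end
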